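(* Let $Q\ge 1$ be an integer, let $K\in\mathbb{R}$ with $K\neq 0$, and put $y=e^{K}$, $x=\frac{y+Q-1}{y-1}$. Then the function $F\to\mathbb{C}$, $g\mapsto T_g(x,y)$, is of positive type on the Thompson group $F$, where for $g=g(T_1,T_2)$ with $T_1,T_2\in\mathcal{T}_n$ one sets $T_g(x,y)=T_{\Gamma(T_1,T_2)}(x,y)\,(x+y)^{-n+1}$.
   Context: **Trees and the Thompson group.** $\mathcal{T}_n$ is the set of rooted planar binary trees (every internal vertex has a left and a right child) with $n$ leaves, the leaves being numbered $1,\dots,n$ from left to right. To the root associate $[0,1]$ and, recursively, to the left/right child of a vertex with interval $I$ the left/right half of $I$; the leaves of $T\in\mathcal{T}_n$ then give a subdivision of $[0,1]$ into $n$ standard dyadic intervals. For $T_+,T_-\in\mathcal{T}_n$, $g(T_+,T_-)$ is the homeomorphism of $[0,1]$ mapping, for each $k$, the interval of the $k$-th leaf of $T_-$ linearly and increasingly onto the interval of the $k$-th leaf of $T_+$. The group $F$ (under composition) consists of all these homeomorphisms; $g(T_+,T_-)^{-1}=g(T_-,T_+)$. Two pairs of trees define the same element of $F$ iff they are connected by a sequence of additions/deletions of opposite carets (adding a pair of opposite carets means: for some $k$, attach to the $k$-th leaf of both trees two children). **The graph $\Gamma(T_+,T_-)$.** For $T\in\mathcal{T}_n$ let $\Gamma_\pm(T)$ be the following tree on the vertices $0,1,\dots,n-1$ (vertex $k\geq 1$ lies between leaves $k$ and $k+1$, vertex $0$ lies to the left of leaf $1$): for every internal vertex $v$ of $T$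 whose left subtree has leaves $a,\dots,m$ and whose right subtree has leaves $m+1,\dots,b$ there is one edge joining $a-1$ and $m$. (This is the part of the dual graph of $T$ given by the edges of $T$ going from a left child up to its parent.) $\Gamma(T_+,T_-)$ is the planar multigraph on the vertices $0,\dots,n-1$ (placed on the $x$-axis) obtained as the union of $\Gamma_+(T_+)$, drawn in the upper half plane, and $\Gamma_-(T_-)$, drawn in the lower half plane; parallel edges are kept. **Tutte polynomial.** For a finite (multi)graph $G$ with vertex set $V(G)$ and edge set $E(G)$, $T_G(x,y)=\sum_{S\subset E(G)}(x-1)^{c(S)-c(E(G))}(y-1)^{c(S)+|S|-|V(G)|}$, where $c(S)$ is the number of connected components of the spanning subgraph $(V(G),S)$. The value $T_g(x,y)$ does not depend on the choice of the pair $(T_1,T_2)$ representing $g$. **Positive type.** A function $\phi:G\to\mathbb{C}$ on a discrete group $G$ is of positive type if for all $r$ and all $g_1,\dots,g_r\in G$ the matrix $(\phi(g_ig_j^{-1}))_{i,j=1}^r$ is positive semidefinite (in particular Hermitian). *)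

theory Defs
  imports Complex_Main "HOL-Library.FuncSet" "HOL-Library.Nonpos_Ints" "HOL-Algebra.Group"
begin

section \<open>Rooted planar binary trees\<close>

datatype btree = Lf | Nd btree btree

fun leaves :: "btree \<Rightarrow> nat" where
  "leaves Lf = 1"
| "leaves (Nd l r) = leaves l + leaves r"

text \<open>The subdivision of the interval \<open>[a,b]\<close> by the leaves of a tree, listed from left to right
  as pairs of end points.\<close>

fun leaf_intervals :: "btree \<Rightarrow> real \<Rightarrow> real \<Rightarrow> (real \<times> real) list" where
  "leaf_intervals Lf a b = [(a, b)]"
| "leaf_intervals (Nd l r) a b =
     leaf_intervals l a ((a + b) / 2) @ leaf_intervals r ((a + b) / 2) b"

section \<open>The Thompson group\<close>

definition affine_map :: "real \<times> real \<Rightarrow> real \<times> real \<Rightarrow> real \<Rightarrow> real" where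
  "affine_map I J x = fst J + (x - fst I) * (snd J - fst J) / (snd I - fst I)"

text \<open>For \<open>leaves Tp = leaves Tm\<close>, the following is the homeomorphism \<open>g(Tp, Tm)\<close> of \<open>[0,1]\<close>, which
  maps the \<open>k\<close>-th leaf interval of \<open>Tm\<close> affinely onto that of \<open>Tp\<close>. A common end point of two
  adjacent intervals is treated as belonging to the left one; lemma \<open>tree_map_leaf\<close> below shows that
  this choice is immaterial.\<close>

definition tree_map :: "btree \<Rightarrow> btree \<Rightarrow> real \<Rightarrow> real" where
  "tree_map Tp Tm = (\<lambda>x\<in>{0..1}.
     let Is = leaf_intervals Tm 0 1; Js = leaf_intervals Tp 0 1;
         k = (LEAST k. k < length Is \<and> x \<in> {fst (Is ! k)..snd (Is ! k)})
     in affine_map (Is ! k) (Js ! k) x)"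

definition thompson_F :: "(real \<Rightarrow> real) monoid" where
  "thompson_F = \<lparr>carrier = {tree_map Tp Tm | Tp Tm. leaves Tp = leaves Tm},
                 mult = (\<lambda>g h. compose {0..1} g h),
                 one = (\<lambda>x\<in>{0..1}. x)\<rparr>"

lemma length_leaf_intervals [simp]: "length (leaf_intervals T a b) = leaves T"
  by (induction T arbitrary: a b) auto

lemma leaves_pos [simp]: "leaves T > 0"
  by (induction T) auto

lemma leaf_intervals_fst_0: "fst (leaf_intervals T a b ! 0) = a"
proof (induction T arbitrary: a b)
  case (Nd l r)
  then show ?case by (simp add: nth_append)
qed simp

lemma leaf_intervals_snd_last: "snd (leaf_intervals T a b ! (leaves T - 1)) = b"
proof (induction T arbitrary: a b)
  case (Nd l r)
  have "leaves l + leaves r - 1 = leaves l + (leaves r - 1)"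
    using leaves_pos[of r] by linarith
  then show ?case using Nd.IH(2)[of "(a + b) / 2" b]
    by (simp add: nth_append del: One_nat_def)
qed simp

lemma leaf_intervals_less:
  assumes "a < b" "k < leaves T"
  shows "fst (leaf_intervals T a b ! k) < snd (leaf_intervals T a b ! k)"
  using assms
proof (induction T arbitrary: a b k)
  case (Nd l r)
  have "a < (a + b) / 2" "(a + b) / 2 < b" using Nd.prems by auto
  then show ?case using Nd.prems Nd.IH by (auto simp: nth_append)
qed simp

lemma leaf_intervals_adjacent:
  assumes "Suc k < leaves T"
  shows "snd (leaf_intervals T a b ! k) = fst (leaf_intervals T a b ! Suc k)"
  using assms
proof (induction T arbitrary: a b k)
  case (Nd l r)
  consider "Suc k < leaves l" | "k = leaves l - 1" | "k \<ge> leaves l" by linarith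
  then show ?case
  proof cases
    case 1
    then show ?thesis using Nd.IH(1) by (simp add: nth_append)
  next
    case 2
    then have k: "k < leaves l" "Suc k = leaves l" using leaves_pos[of l] by linarith+
    then have "snd (leaf_intervals l a ((a + b) / 2) ! k) = (a + b) / 2"
      using leaf_intervals_snd_last[of l a "(a + b) / 2"] 2 by simp
    then show ?thesis using k leaf_intervals_fst_0[of r "(a + b) / 2" b]
      by (simp add: nth_append)
  next
    case 3
    then have "Suc (k - leaves l) < leaves r" "Suc k - leaves l = Suc (k - leaves l)"
      using Nd.prems by auto
    then show ?thesis using 3 Nd.IH(2)[of "k - leaves l"] by (simp add: nth_append)
  qed
qed simp

lemma leaf_intervals_ordered:
  assumes "a < b" "i < j" "j < leaves T"
  shows "snd (leaf_intervals T a b ! i) \<le> fst (leaf_intervals T a b ! j)"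
  using assms(2,3)
proof (induction j)
  case (Suc j)
  show ?case
  proof (cases "i = j")
    case True
    then show ?thesis using leaf_intervals_adjacent[OF Suc.prems(2)] by simp
  next
    case False
    then have "snd (leaf_intervals T a b ! i) \<le> fst (leaf_intervals T a b ! j)"
      using Suc by simp
    also have "\<dots> < snd (leaf_intervals T a b ! j)"
      using Suc.prems assms(1) leaf_intervals_less by simp
    finally show ?thesis using leaf_intervals_adjacent[OF Suc.prems(2), of a b] by simp
  qed
qed simp

lemma leaf_intervals_subset:
  assumes "k < leaves T"
  shows "{fst (leaf_intervals T 0 1 ! k)..snd (leaf_intervals T 0 1 ! k)} \<subseteq> {0..1}"
proof -
  have "0 \<le> fst (leaf_intervals T 0 1 ! k)"
    using leaf_intervals_ordered[of 0 1 0 k T] leaf_intervals_less[of 0 1 0 T]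
      leaf_intervals_fst_0[of T 0 1] assms by (cases "k = 0") auto
  moreover have "snd (leaf_intervals T 0 1 ! k) \<le> 1"
  proof (cases "k = leaves T - 1")
    case True
    then show ?thesis using leaf_intervals_snd_last[of T 0 1] by simp
  next
    case False
    then have "k < leaves T - 1" using assms by simp
    then have "snd (leaf_intervals T 0 1 ! k) \<le> fst (leaf_intervals T 0 1 ! (leaves T - 1))"
      by (intro leaf_intervals_ordered) simp_all
    also have "\<dots> < snd (leaf_intervals T 0 1 ! (leaves T - 1))"
      by (intro leaf_intervals_less) simp_all
    finally show ?thesis using leaf_intervals_snd_last[of T 0 1] by simp
  qed
  ultimately show ?thesis by auto
qed

lemma tree_map_leaf:
  assumes "leaves Tp = leaves Tm" "k < leaves Tm"
    and x: "x \<in> {fst (leaf_intervals Tm 0 1 ! k)..snd (leaf_intervals Tm 0 1 ! k)}"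
  shows "tree_map Tp Tm x = affine_map (leaf_intervals Tm 0 1 ! k) (leaf_intervals Tp 0 1 ! k) x"
proof -
  define I where "I = (\<lambda>k. leaf_intervals Tm 0 1 ! k)"
  define J where "J = (\<lambda>k. leaf_intervals Tp 0 1 ! k)"
  define P where "P = (\<lambda>k. k < leaves Tm \<and> x \<in> {fst (I k)..snd (I k)})"
  define j where "j = (LEAST k. P k)"
  have Pk: "P k" using assms by (simp add: P_def I_def)
  have Pj: "P j" and jk: "j \<le> k"
    unfolding j_def using LeastI[of P, OF Pk] Least_le[of P, OF Pk] by auto
  have "x \<in> {0..1}" using leaf_intervals_subset assms by blast
  then have tm: "tree_map Tp Tm x = affine_map (I j) (J j) x"
    by (simp add: tree_map_def Let_def j_def P_def I_def J_def)
  have "affine_map (I j) (J j) x = affine_map (I k) (J k) x"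
  proof (cases "j = k")
    case False
    with jk have lt: "j < k" by simp
    have "snd (I j) \<le> fst (I k)"
      unfolding I_def using lt assms by (intro leaf_intervals_ordered) auto
    with Pj Pk have xs: "x = snd (I j)" "x = fst (I k)" by (auto simp: P_def)
    have kS: "k = Suc j"
    proof (rule ccontr)
      assume "k \<noteq> Suc j"
      with lt have lt2: "Suc j < k" by simp
      have "snd (I (Suc j)) \<le> fst (I k)"
        unfolding I_def using lt2 assms by (intro leaf_intervals_ordered) auto
      moreover have "fst (I (Suc j)) < snd (I (Suc j))"
        unfolding I_def using lt2 assms by (intro leaf_intervals_less) auto
      moreover have "snd (I j) \<le> fst (I (Suc j))"
        unfolding I_def using lt2 assms by (intro leaf_intervals_ordered) auto
      ultimately show False using xs by simp
    qed
    have "snd (J j) = fst (J k)"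
      unfolding J_def kS using assms kS by (intro leaf_intervals_adjacent) auto
    moreover have "fst (I j) < snd (I j)"
      unfolding I_def using lt assms by (intro leaf_intervals_less) auto
    ultimately show ?thesis
      using xs unfolding affine_map_def by (simp add: xs(1))
  qed simp
  with tm show ?thesis by (simp add: I_def J_def)
qed

section \<open>Finite multigraphs and the Tutte polynomial\<close>

text \<open>An edge \<open>e\<close> is incident with the two components of \<open>ends e\<close>; the order of these components is
  irrelevant, since graphs are undirected. Different edges may have the same ends.\<close>

record ('v, 'e) multigraph =
  verts :: "'v set"
  edges :: "'e set"
  ends :: "'e \<Rightarrow> 'v \<times> 'v"

definition connection :: "('v, 'e) multigraph \<Rightarrow> 'e set \<Rightarrow> ('v \<times> 'v) set" where
  "connection G S = {(u, v) \<in> verts G \<times> verts G. (u, v) \<in> (ends G ` S \<union> (ends G ` S)\<inverse>)\<^sup>*}"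

definition num_components :: "('v, 'e) multigraph \<Rightarrow> 'e set \<Rightarrow> nat" where
  "num_components G S = card (verts G // connection G S)"

text \<open>For finite \<open>G\<close> both exponents are nonnegative, so truncated subtraction is harmless.\<close>

definition tutte :: "('v, 'e) multigraph \<Rightarrow> 'a::comm_ring_1 \<Rightarrow> 'a \<Rightarrow> 'a" where
  "tutte G x y = (\<Sum>S\<in>Pow (edges G).
     (x - 1) ^ (num_components G S - num_components G (edges G)) *
     (y - 1) ^ (num_components G S + card S - card (verts G)))"

section \<open>The graph of a pair of trees\<close>

text \<open>\<open>half_edges s T\<close> lists the edges contributed by a tree whose leaves are numbered
  \<open>s + 1, \<dots>, s + leaves T\<close>. An internal vertex with left leaves \<open>a, \<dots>, m\<close> contributes the edge
  \<open>(a - 1, m)\<close>. Distinct internal vertices have distinct \<open>m\<close>, so that no edges are identified by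
  collecting them in a set.\<close>

fun half_edges :: "nat \<Rightarrow> btree \<Rightarrow> (nat \<times> nat) set" where
  "half_edges s Lf = {}"
| "half_edges s (Nd l r) =
     insert (s, s + leaves l) (half_edges s l \<union> half_edges (s + leaves l) r)"

text \<open>The disjoint sum keeps an upper edge apart from a lower edge with the same ends.\<close>

definition tree_graph ::
  "btree \<Rightarrow> btree \<Rightarrow> (nat, (nat \<times> nat) + (nat \<times> nat)) multigraph" where
  "tree_graph Tp Tm = \<lparr>verts = {0..<leaves Tp},
                       edges = half_edges 0 Tp <+> half_edges 0 Tm,
                       ends = case_sum id id\<rparr>"

text \<open>The normalised Tutte polynomial \<open>T\<^sub>g(x,y)\<close>, computed from any pair of trees representing \<open>g\<close>;
  the value is independent of the pair.\<close>

definition thompson_tutte :: "real \<Rightarrow> real \<Rightarrow> (real \<Rightarrow> real) \<Rightarrow> real" where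
  "thompson_tutte x y g = (SOME v. \<exists>T1 T2. leaves T1 = leaves T2 \<and> g = tree_map T1 T2 \<and>
     v = tutte (tree_graph T1 T2) x y * (x + y) powi (1 - int (leaves T1)))"

section \<open>Functions of positive type\<close>

definition pos_semidef :: "nat \<Rightarrow> (nat \<Rightarrow> nat \<Rightarrow> complex) \<Rightarrow> bool" where
  "pos_semidef r M \<longleftrightarrow>
     (\<forall>i<r. \<forall>j<r. M j i = cnj (M i j)) \<and>
     (\<forall>c :: nat \<Rightarrow> complex. (\<Sum>i<r. \<Sum>j<r. cnj (c i) * M i j * c j) \<in> \<real>\<^sub>\<ge>\<^sub>0)"

definition positive_type :: "('a, 'b) monoid_scheme \<Rightarrow> ('a \<Rightarrow> complex) \<Rightarrow> bool" where
  "positive_type G \<phi> \<longleftrightarrow>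
     (\<forall>r. \<forall>g :: nat \<Rightarrow> 'a. (\<forall>i<r. g i \<in> carrier G) \<longrightarrow>
        pos_semidef r (\<lambda>i j. \<phi> (g i \<otimes>\<^bsub>G\<^esub> inv\<^bsub>G\<^esub> g j)))"

end

theory Submission
  imports Defs
begin

text \<open>Since \<open>(x - 1) (y - 1) = Q\<close>, the Tutte polynomial of a connected graph is, up to the factor
  \<open>Q (y - 1)^(n - 1)\<close>, the Potts partition function: the sum over all \<open>Q\<close>-colourings of the vertices
  of the product of the weights \<open>y\<close> (equal colours) or \<open>1\<close> of the edges. For \<open>\<Gamma>(T\<^sub>+, T\<^sub>-)\<close> this
  product splits into an upper and a lower half, so that the partition function is the inner product
  of two real vectors \<open>w(T\<^sub>+)\<close>, \<open>w(T\<^sub>-)\<close> indexed by the colourings. A pair of opposite carets adds a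
  vertex with a double edge to its left neighbour; summing over its colour gives the factor
  \<open>y\<^sup>2 + Q - 1 = (x + y) (y - 1)\<close>, which the normalisation cancels. Finally, any \<open>g\<^sub>1, \<dots>, g\<^sub>r\<close> can be
  written as \<open>g\<^sub>i = g(A\<^sub>i, C)\<close> with a common tree \<open>C\<close>, whence \<open>g\<^sub>i g\<^sub>j\<^sup>-\<^sup>1 = g(A\<^sub>i, A\<^sub>j)\<close>, and the matrix
  is a nonnegative multiple of the Gram matrix of the vectors \<open>w(A\<^sub>i)\<close>.\<close>

section \<open>Tree diagrams and refinement\<close>

fun add_caret :: "nat \<Rightarrow> btree \<Rightarrow> btree" where
  "add_caret k Lf = Nd Lf Lf"
| "add_caret k (Nd l r) =
     (if k < leaves l then Nd (add_caret k l) r else Nd l (add_caret (k - leaves l) r))"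

lemma leaves_add_caret [simp]: "leaves (add_caret k T) = Suc (leaves T)"
  by (induction k T rule: add_caret.induct) auto

text \<open>The larger tree stands on the right. Growth by single carets lets invariance under one
  pair of opposite carets extend by induction.\<close>

inductive refines :: "btree \<Rightarrow> btree \<Rightarrow> bool" for S where
  refines_refl: "refines S S"
| refines_caret: "refines S T \<Longrightarrow> k < leaves T \<Longrightarrow> refines S (add_caret k T)"

lemma refines_trans:
  assumes "refines S T" "refines T U"
  shows "refines S U"
  using assms(2,1) by induction (auto intro: refines_caret)

lemma refines_Nd:
  assumes "refines l l'" "refines r r'"
  shows "refines (Nd l r) (Nd l' r')"
proof -
  have "refines (Nd l r) (Nd l' r)"
    using assms(1)
  proof induction
    case (refines_caret T k)
    then show ?case using refines.refines_caret[of "Nd l r" "Nd T r" k] by simp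
  qed (rule refines_refl)
  moreover have "refines (Nd l' r) (Nd l' r')"
    using assms(2)
  proof induction
    case (refines_caret T k)
    then show ?case using refines.refines_caret[of "Nd l' r" "Nd l' T" "leaves l' + k"] by simp
  qed (rule refines_refl)
  ultimately show ?thesis by (rule refines_trans)
qed

fun full_tree :: "nat \<Rightarrow> btree" where
  "full_tree 0 = Lf"
| "full_tree (Suc d) = Nd (full_tree d) (full_tree d)"

fun depth :: "btree \<Rightarrow> nat" where
  "depth Lf = 0"
| "depth (Nd l r) = Suc (max (depth l) (depth r))"

text \<open>Complete trees serve as common refinements: one complete tree of large depth lies above
  any given finite family of trees.\<close>

lemma refines_full_tree: "depth T \<le> d \<Longrightarrow> refines T (full_tree d)"
proof (induction T arbitrary: d)
  case Lf
  show ?case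
  proof (induction d)
    case (Suc d)
    have "refines Lf (Nd Lf Lf)"
      using refines_caret[OF refines_refl, of 0 Lf] by simp
    with refines_Nd[OF Suc Suc] show ?case
      by (auto intro: refines_trans)
  qed (simp add: refines_refl)
next
  case (Nd l r)
  then show ?case by (cases d) (auto intro: refines_Nd)
qed

section \<open>Leaf intervals: carets, covering, reconstruction of the tree\<close>

lemma leaf_intervals_add_caret:
  assumes "k < leaves T" "j \<le> leaves T"
  shows "leaf_intervals (add_caret k T) a b ! j =
    (let L = leaf_intervals T a b; m = (fst (L ! k) + snd (L ! k)) / 2
     in if j < k then L ! j else if j = k then (fst (L ! k), m)
        else if j = Suc k then (m, snd (L ! k)) else L ! (j - 1))"
  using assms
proof (induction T arbitrary: a b k j)
  case Lf
  then show ?case by (auto simp: Let_def le_Suc_eq)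
next
  case (Nd l r)
  let ?m = "(a + b) / 2"
  show ?case
  proof (cases "k < leaves l")
    case True
    show ?thesis
    proof (cases "j \<le> leaves l")
      case j: True
      then show ?thesis using True Nd.IH(1)[OF True j, of a ?m]
        by (auto simp: nth_append Let_def less_Suc_eq_le)
    next
      case False
      then have "j - Suc (leaves l) = j - 1 - leaves l" by simp
      then show ?thesis using True False by (auto simp: nth_append Let_def)
    qed
  next
    case False
    show ?thesis
    proof (cases "j < leaves l")
      case j: True
      then show ?thesis using False by (auto simp: nth_append Let_def)
    next
      case j: False
      have "k - leaves l < leaves r" "j - leaves l \<le> leaves r"
        using Nd.prems False by auto
      from Nd.IH(2)[OF this, of ?m b] False j show ?thesis
        by (auto simp: nth_append Let_def Suc_diff_le diff_commute)
    qed
  qed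
qed

lemma leaf_intervals_cover:
  assumes "x \<in> {a..b}"
  shows "\<exists>k<leaves T. x \<in> {fst (leaf_intervals T a b ! k)..snd (leaf_intervals T a b ! k)}"
  using assms
proof (induction T arbitrary: a b)
  case (Nd l r)
  show ?case
  proof (cases "x \<le> (a + b) / 2")
    case True
    with Nd.prems obtain k where "k < leaves l"
      "x \<in> {fst (leaf_intervals l a ((a + b) / 2) ! k)..snd (leaf_intervals l a ((a + b) / 2) ! k)}"
      using Nd.IH(1)[of a "(a + b) / 2"] by auto
    then show ?thesis by (intro exI[of _ k]) (auto simp: nth_append)
  next
    case False
    with Nd.prems obtain k where "k < leaves r"
      "x \<in> {fst (leaf_intervals r ((a + b) / 2) b ! k)..snd (leaf_intervals r ((a + b) / 2) b ! k)}"
      using Nd.IH(2)[of "(a + b) / 2" b] by auto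
    then show ?thesis by (intro exI[of _ "leaves l + k"]) (auto simp: nth_append)
  qed
qed auto

lemma leaf_intervals_bounds:
  assumes "a < b" "I \<in> set (leaf_intervals T a b)"
  shows "a \<le> fst I \<and> fst I < snd I \<and> snd I \<le> b"
  using assms
proof (induction T arbitrary: a b)
  case (Nd l r)
  then show ?case using Nd.IH(1)[of a "(a + b) / 2"] Nd.IH(2)[of "(a + b) / 2" b] by auto
qed auto

text \<open>The midpoint of \<open>[a,b]\<close> separates the two subtrees: an interval ends at or
  before it exactly when it belongs to a leaf of the left subtree. Filtering the list therefore
  recovers both sublists.\<close>

lemma leaf_intervals_inj:
  assumes "a < b" "leaf_intervals S a b = leaf_intervals T a b"
  shows "S = T"
  using assms
proof (induction S arbitrary: T a b)
  case Lf
  have "leaves T = 1" using arg_cong[OF Lf.prems(2), of length] by simp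
  then show ?case
    using leaves_pos by (cases T) (auto simp: add_is_1 simp flip: neq0_conv)
next
  case (Nd l r)
  let ?m = "(a + b) / 2"
  have "leaves T \<noteq> 1"
    using arg_cong[OF Nd.prems(2), of length] leaves_pos[of l] leaves_pos[of r] by (simp del: leaves_pos)
  then obtain l' r' where T: "T = Nd l' r'" by (cases T) auto
  have m: "a < ?m" "?m < b" using Nd.prems by auto
  have split:
    "filter (\<lambda>I. snd I \<le> ?m) (leaf_intervals (Nd u v) a b) = leaf_intervals u a ?m"
    "filter (\<lambda>I. \<not> snd I \<le> ?m) (leaf_intervals (Nd u v) a b) = leaf_intervals v ?m b" for u v
  proof -
    have "snd I \<le> ?m" if "I \<in> set (leaf_intervals u a ?m)" for I
      using leaf_intervals_bounds[OF m(1) that] by simp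
    moreover have "\<not> snd I \<le> ?m" if "I \<in> set (leaf_intervals v ?m b)" for I
      using leaf_intervals_bounds[OF m(2) that] by simp
    ultimately show
      "filter (\<lambda>I. snd I \<le> ?m) (leaf_intervals (Nd u v) a b) = leaf_intervals u a ?m"
      "filter (\<lambda>I. \<not> snd I \<le> ?m) (leaf_intervals (Nd u v) a b) = leaf_intervals v ?m b"
      by (simp_all add: filter_empty_conv filter_id_conv del: not_le)
  qed
  have "leaf_intervals l a ?m = leaf_intervals l' a ?m"
    "leaf_intervals r ?m b = leaf_intervals r' ?m b"
    using split Nd.prems(2) T by metis+
  then show ?case using Nd.IH m T by blast
qed

section \<open>The group structure\<close>

lemma affine_map_mem:
  assumes "fst I < snd I" "fst J \<le> snd J" "x \<in> {fst I..snd I}"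
  shows "affine_map I J x \<in> {fst J..snd J}"
proof -
  let ?t = "(x - fst I) / (snd I - fst I)"
  have t: "0 \<le> ?t" "?t \<le> 1" using assms by auto
  have "affine_map I J x = fst J + ?t * (snd J - fst J)"
    by (simp add: affine_map_def)
  moreover have "?t * (snd J - fst J) \<le> 1 * (snd J - fst J)"
    by (rule mult_right_mono) (use t assms in auto)
  ultimately show ?thesis using t assms by auto
qed

lemma affine_map_comp:
  assumes "fst J < snd J"
  shows "affine_map J K (affine_map I J x) = affine_map I K x"
  using assms by (simp add: affine_map_def)

lemma affine_map_fst [simp]: "affine_map I J (fst I) = fst J"
  by (simp add: affine_map_def)

lemma affine_map_snd [simp]: "fst I < snd I \<Longrightarrow> affine_map I J (snd I) = snd J"
  by (simp add: affine_map_def)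

lemma tree_map_extensional: "tree_map A B \<in> extensional {0..1}"
  by (simp add: tree_map_def)

lemma tree_map_leaf_mem:
  assumes "leaves A = leaves B" "k < leaves B"
    and "x \<in> {fst (leaf_intervals B 0 1 ! k)..snd (leaf_intervals B 0 1 ! k)}"
  shows "tree_map A B x \<in> {fst (leaf_intervals A 0 1 ! k)..snd (leaf_intervals A 0 1 ! k)}"
  using affine_map_mem[OF _ _ assms(3)] leaf_intervals_less[of 0 1 k] assms
  by (simp add: tree_map_leaf less_imp_le)

lemma tree_map_funcset:
  assumes "leaves A = leaves B"
  shows "tree_map A B \<in> {0..1} \<rightarrow> {0..1}"
proof
  fix x :: real assume "x \<in> {0..1}"
  then obtain k where "k < leaves B"
    "x \<in> {fst (leaf_intervals B 0 1 ! k)..snd (leaf_intervals B 0 1 ! k)}"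
    using leaf_intervals_cover by blast
  then show "tree_map A B x \<in> {0..1}"
    using tree_map_leaf_mem[OF assms, of k x] leaf_intervals_subset[of k A] assms by (simp add: subset_iff)
qed

text \<open>\<open>tree_map B C\<close> carries the \<open>k\<close>-th interval of \<open>C\<close>
  into the \<open>k\<close>-th interval of \<open>B\<close>, so both factors use the same index and
  their affine pieces compose.\<close>

lemma tree_map_comp:
  assumes "leaves A = leaves B" "leaves B = leaves C"
  shows "compose {0..1} (tree_map A B) (tree_map B C) = tree_map A C"
proof (rule extensionalityI[OF compose_extensional tree_map_extensional])
  fix x :: real assume x: "x \<in> {0..1}"
  then obtain k where k: "k < leaves C"
    "x \<in> {fst (leaf_intervals C 0 1 ! k)..snd (leaf_intervals C 0 1 ! k)}"
    using leaf_intervals_cover by blast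
  have "tree_map A B (tree_map B C x) = tree_map A C x"
    using tree_map_leaf_mem[OF assms(2) k] k assms leaf_intervals_less[of 0 1 k B]
    by (subst tree_map_leaf[of A B k]) (auto simp: tree_map_leaf affine_map_comp)
  then show "compose {0..1} (tree_map A B) (tree_map B C) x = tree_map A C x"
    using x by (simp add: compose_eq)
qed

lemma tree_map_refl: "tree_map A A = (\<lambda>x\<in>{0..1}. x)"
proof (rule extensionalityI[OF tree_map_extensional restrict_extensional])
  fix x :: real assume x: "x \<in> {0..1}"
  then obtain k where k: "k < leaves A"
    "x \<in> {fst (leaf_intervals A 0 1 ! k)..snd (leaf_intervals A 0 1 ! k)}"
    using leaf_intervals_cover by blast
  then show "tree_map A A x = (\<lambda>x\<in>{0..1}. x) x"
    using x leaf_intervals_less[of 0 1 k A] by (simp add: tree_map_leaf[OF refl k] affine_map_def)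
qed

text \<open>Values at the end points of the intervals of \<open>C\<close> reveal the subdivision of
  the range tree, and this determines the tree. Hence an element has at most one numerator over a
  fixed denominator \<open>C\<close>.\<close>

lemma tree_map_inj:
  assumes "leaves A = leaves C" "leaves B = leaves C" "tree_map A C = tree_map B C"
  shows "A = B"
proof -
  have "leaf_intervals A 0 1 ! k = leaf_intervals B 0 1 ! k" if k: "k < leaves C" for k
  proof (rule prod_eqI)
    let ?I = "leaf_intervals C 0 1 ! k"
    have less: "fst ?I < snd ?I" using leaf_intervals_less[of 0 1] k by simp
    show "fst (leaf_intervals A 0 1 ! k) = fst (leaf_intervals B 0 1 ! k)"
      using tree_map_leaf[OF assms(1) k, of "fst ?I"] tree_map_leaf[OF assms(2) k, of "fst ?I"]
        assms(3) less by simp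
    show "snd (leaf_intervals A 0 1 ! k) = snd (leaf_intervals B 0 1 ! k)"
      using tree_map_leaf[OF assms(1) k, of "snd ?I"] tree_map_leaf[OF assms(2) k, of "snd ?I"]
        assms(3) less by simp
  qed
  then have "leaf_intervals A 0 1 = leaf_intervals B 0 1"
    using assms by (intro nth_equalityI) auto
  then show ?thesis by (intro leaf_intervals_inj[of 0 1]) auto
qed

text \<open>An affine map sends midpoint to midpoint, so it agrees with the affine maps between the
  halves cut off by the opposite carets.\<close>

lemma tree_map_add_caret:
  assumes "leaves A = leaves B" "k < leaves B"
  shows "tree_map (add_caret k A) (add_caret k B) = tree_map A B"
proof (rule extensionalityI[OF tree_map_extensional tree_map_extensional])
  fix x :: real assume "x \<in> {0..1}"
  then obtain j where j: "j < leaves (add_caret k B)"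
    "x \<in> {fst (leaf_intervals (add_caret k B) 0 1 ! j)..
            snd (leaf_intervals (add_caret k B) 0 1 ! j)}"
    using leaf_intervals_cover by blast
  \<comment> \<open>Index of the old leaf containing the new leaf \<open>j\<close>: both
    \<open>k\<close> and \<open>Suc k\<close> come from \<open>k\<close>, and later leaves move back
    by one.\<close>
  let ?i = "if j \<le> k then j else j - 1"
  let ?I = "leaf_intervals B 0 1 ! ?i" and ?J = "leaf_intervals A 0 1 ! ?i"
  have i: "?i < leaves B" using j assms by auto
  have less: "fst ?I < snd ?I" using leaf_intervals_less[OF _ i, of 0 1] by simp
  note carets = leaf_intervals_add_caret[of k A j 0 1] leaf_intervals_add_caret[of k B j 0 1]
  have "x \<in> {fst ?I..snd ?I}"
    using carets(2) j assms less by (auto simp: Let_def split: if_splits)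
  then have "tree_map A B x = affine_map ?I ?J x"
    by (rule tree_map_leaf[OF assms(1) i])
  moreover have "affine_map (leaf_intervals (add_caret k B) 0 1 ! j)
      (leaf_intervals (add_caret k A) 0 1 ! j) x = affine_map ?I ?J x"
    using carets j(1) assms less
    by (auto simp: Let_def affine_map_def divide_simps) (auto simp: algebra_simps)
  ultimately show "tree_map (add_caret k A) (add_caret k B) x = tree_map A B x"
    using tree_map_leaf[OF _ j] assms by simp
qed

text \<open>Each caret grown on the domain tree is copied at the same leaf of the range
  tree.\<close>

lemma refines_tree_map:
  assumes "refines B C" "leaves A = leaves B"
  shows "\<exists>A'. leaves A' = leaves C \<and> tree_map A' C = tree_map A B"
  using assms
proof induction
  case (refines_caret T k)
  then obtain A' where "leaves A' = leaves T" "tree_map A' T = tree_map A B" by blast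
  then show ?case using tree_map_add_caret refines_caret
    by (intro exI[of _ "add_caret k A'"]) auto
qed auto

lemma thompson_F_common_denominator:
  assumes "finite X" "X \<subseteq> carrier thompson_F"
  obtains C where "\<And>g. g \<in> X \<Longrightarrow> \<exists>A. leaves A = leaves C \<and> g = tree_map A C"
proof -
  have "\<forall>g\<in>X. \<exists>B. \<exists>A. leaves A = leaves B \<and> g = tree_map A B"
    using assms(2) by (fastforce simp: thompson_F_def)
  then obtain B where B: "\<And>g. g \<in> X \<Longrightarrow> \<exists>A. leaves A = leaves (B g) \<and> g = tree_map A (B g)"
    by (metis (no_types))
  \<comment> \<open>\<open>insert 0\<close> keeps the maximum meaningful when \<open>X\<close> is
    empty.\<close>
  define d where "d = Max (insert 0 ((depth \<circ> B) ` X))"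
  have "depth (B g) \<le> d" if "g \<in> X" for g
    unfolding d_def using that assms(1) by (intro Max_ge) auto
  then have "\<exists>A. leaves A = leaves (full_tree d) \<and> g = tree_map A (full_tree d)" if "g \<in> X" for g
    using refines_tree_map[OF refines_full_tree] B that by metis
  then show ?thesis using that by blast
qed

section \<open>Group axioms and inverses\<close>

lemma carrier_thompson_F_iff:
  "g \<in> carrier thompson_F \<longleftrightarrow> (\<exists>A B. leaves A = leaves B \<and> g = tree_map A B)"
  by (auto simp: thompson_F_def)

lemma tree_map_in_carrier [intro]:
  "leaves A = leaves B \<Longrightarrow> tree_map A B \<in> carrier thompson_F"
  by (auto simp: carrier_thompson_F_iff)

lemma thompson_F_mult:
  assumes "leaves A = leaves B" "leaves B = leaves C"
  shows "tree_map A B \<otimes>\<^bsub>thompson_F\<^esub> tree_map B C = tree_map A C"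
  using tree_map_comp[OF assms] by (simp add: thompson_F_def)

lemma thompson_F_one: "\<one>\<^bsub>thompson_F\<^esub> = tree_map A A"
  by (simp add: thompson_F_def tree_map_refl)

lemma thompson_F_assoc:
  assumes "h \<in> carrier thompson_F"
  shows "f \<otimes>\<^bsub>thompson_F\<^esub> g \<otimes>\<^bsub>thompson_F\<^esub> h = f \<otimes>\<^bsub>thompson_F\<^esub> (g \<otimes>\<^bsub>thompson_F\<^esub> h)"
proof -
  have "h \<in> {0..1} \<rightarrow> {0..1}"
    using assms tree_map_funcset by (auto simp: carrier_thompson_F_iff)
  from compose_assoc[OF this, of f g] show ?thesis by (simp add: thompson_F_def)
qed

lemma thompson_F_l_one:
  assumes "g \<in> carrier thompson_F"
  shows "\<one>\<^bsub>thompson_F\<^esub> \<otimes>\<^bsub>thompson_F\<^esub> g = g"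
  using assms thompson_F_one thompson_F_mult by (metis carrier_thompson_F_iff)

lemma thompson_F_r_one:
  assumes "g \<in> carrier thompson_F"
  shows "g \<otimes>\<^bsub>thompson_F\<^esub> \<one>\<^bsub>thompson_F\<^esub> = g"
  using assms thompson_F_one thompson_F_mult by (metis carrier_thompson_F_iff)

text \<open>Both sides are inverse to the same map, so they agree by uniqueness of inverses. The
  argument uses only associativity and the unit laws because the proof of closure in
  \<open>group_thompson_F\<close> relies on it.\<close>

lemma tree_map_swap:
  assumes "leaves A = leaves B" "leaves C = leaves D" "tree_map A B = tree_map C D"
  shows "tree_map B A = tree_map D C"
proof -
  have "tree_map D C = tree_map D C \<otimes>\<^bsub>thompson_F\<^esub> (tree_map C D \<otimes>\<^bsub>thompson_F\<^esub> tree_map B A)"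
    using assms thompson_F_one thompson_F_mult[of A B A] thompson_F_r_one[of "tree_map D C"]
    by (metis tree_map_in_carrier)
  also have "\<dots> = tree_map B A"
    using assms thompson_F_one thompson_F_mult[of D C D] thompson_F_l_one[of "tree_map B A"]
      thompson_F_assoc by (metis tree_map_in_carrier)
  finally show ?thesis by simp
qed

lemma group_thompson_F: "group thompson_F"
proof (rule groupI)
  fix g h assume "g \<in> carrier thompson_F" "h \<in> carrier thompson_F"
  then obtain A B C D where gh: "leaves A = leaves B" "g = tree_map A B"
    "leaves C = leaves D" "h = tree_map C D"
    by (auto simp: carrier_thompson_F_iff)
  \<comment> \<open>A common denominator \<open>E\<close> for \<open>g\<close> and the inverse of
    \<open>h\<close> becomes the middle tree of the product \<open>g h\<close>.\<close>
  have "{g, tree_map D C} \<subseteq> carrier thompson_F" using gh by auto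
  then obtain E where E: "\<And>x. x \<in> {g, tree_map D C} \<Longrightarrow> \<exists>A. leaves A = leaves E \<and> x = tree_map A E"
    by (rule thompson_F_common_denominator[rotated]) auto
  then obtain A' D' where A': "leaves A' = leaves E" "g = tree_map A' E"
    and D': "leaves D' = leaves E" "tree_map D C = tree_map D' E" by blast
  have "h = tree_map E D'" using tree_map_swap[OF _ D'(1) D'(2)] gh by simp
  then show "g \<otimes>\<^bsub>thompson_F\<^esub> h \<in> carrier thompson_F"
    using A' D' by (simp add: thompson_F_mult tree_map_in_carrier)
next
  fix g assume "g \<in> carrier thompson_F"
  then show "\<exists>h\<in>carrier thompson_F. h \<otimes>\<^bsub>thompson_F\<^esub> g = \<one>\<^bsub>thompson_F\<^esub>"
    by (metis carrier_thompson_F_iff thompson_F_mult thompson_F_one)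
next
  show "\<one>\<^bsub>thompson_F\<^esub> \<in> carrier thompson_F"
    by (auto simp: thompson_F_one[of Lf])
qed (auto simp: thompson_F_assoc thompson_F_l_one)

lemma thompson_F_inv:
  assumes "leaves A = leaves B"
  shows "inv\<^bsub>thompson_F\<^esub> tree_map A B = tree_map B A"
  by (rule group.inv_equality[OF group_thompson_F])
    (use assms in \<open>auto simp: thompson_F_mult thompson_F_one[symmetric]\<close>)

section \<open>The Potts partition function\<close>

text \<open>Partition function of the Potts model with states \<open>C\<close> and Boltzmann weight
  \<open>y\<close>. Extensional functions count each colouring of the vertices once.\<close>

definition potts :: "('v, 'e) multigraph \<Rightarrow> 'c set \<Rightarrow> 'a::comm_ring_1 \<Rightarrow> 'a" where
  "potts G C y = (\<Sum>\<sigma>\<in>verts G \<rightarrow>\<^sub>E C. \<Prod>e\<in>edges G.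
     if \<sigma> (fst (ends G e)) = \<sigma> (snd (ends G e)) then y else 1)"

locale finite_multigraph =
  fixes G :: "('v, 'e) multigraph"
  assumes finite_verts [simp]: "finite (verts G)"
    and finite_edges [simp]: "finite (edges G)"
    and ends_in_verts: "ends G ` edges G \<subseteq> verts G \<times> verts G"
begin

section \<open>Connected components of spanning subgraphs\<close>

abbreviation links :: "'e set \<Rightarrow> ('v \<times> 'v) set" where
  "links S \<equiv> ends G ` S \<union> (ends G ` S)\<inverse>"

lemma links_sym: "(u, v) \<in> (links S)\<^sup>* \<Longrightarrow> (v, u) \<in> (links S)\<^sup>*"
  by (rule symD[OF sym_rtrancl]) (auto simp: sym_def)

lemma equiv_connection: "equiv (verts G) (connection G S)"
proof (rule equivI)
  show "connection G S \<subseteq> verts G \<times> verts G" "refl_on (verts G) (connection G S)"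
    by (auto simp: connection_def refl_on_def)
  show "sym (connection G S)"
    using links_sym by (auto simp: connection_def sym_def)
  show "trans (connection G S)"
    by (auto simp: connection_def trans_def)
qed

lemma finite_quotient_connection [simp]: "finite (verts G // connection G S)"
  by (rule finite_quotient) (auto simp: connection_def)

lemma connection_mono: "S \<subseteq> S' \<Longrightarrow> connection G S \<subseteq> connection G S'"
  using rtrancl_mono[of "links S" "links S'"] by (fastforce simp: connection_def)

lemma connection_Image_class:
  assumes "S \<subseteq> S'" "v \<in> verts G"
  shows "connection G S' `` (connection G S `` {v}) = connection G S' `` {v}"
  using connection_mono[OF assms(1)] assms(2) equiv_connection[of S] equiv_connection[of S']
  by (auto elim!: equivE dest: transD refl_onD)

lemma num_components_antimono:
  assumes "S \<subseteq> S'"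
  shows "num_components G S' \<le> num_components G S"
proof -
  have "verts G // connection G S' \<subseteq> (\<lambda>X. connection G S' `` X) ` (verts G // connection G S)"
  proof
    fix Y assume "Y \<in> verts G // connection G S'"
    then obtain v where v: "v \<in> verts G" "Y = connection G S' `` {v}" by (auto elim: quotientE)
    then show "Y \<in> (\<lambda>X. connection G S' `` X) ` (verts G // connection G S)"
      using connection_Image_class[OF assms v(1)] by (metis imageI quotientI)
  qed
  then show ?thesis unfolding num_components_def by (rule surj_card_le[rotated]) simp
qed

text \<open>Cutting a path at its passages through \<open>e\<close> leaves old paths to the ends of
  \<open>e\<close>. The conclusion mentions only \<open>u\<close> because
  \<open>num_components_insert\<close> singles out the class of \<open>u\<close>.\<close>

lemma links_insert_path:
  assumes "ends G e = (u, v)" "(a, b) \<in> (links (insert e S))\<^sup>*"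
  shows "(a, b) \<in> (links S)\<^sup>* \<or> (a, u) \<in> (links S)\<^sup>* \<or> (u, b) \<in> (links S)\<^sup>*"
proof -
  \<comment> \<open>The induction keeps track of both ends of \<open>e\<close>: a path can cross it
    in either direction, and crossing back returns to the first case.\<close>
  have "(a, b) \<in> (links S)\<^sup>* \<or> (a, u) \<in> (links S)\<^sup>* \<and> (v, b) \<in> (links S)\<^sup>*
     \<or> (a, v) \<in> (links S)\<^sup>* \<and> (u, b) \<in> (links S)\<^sup>*"
    using assms(2)
  proof induction
    case (step b c)
    then consider "(b, c) \<in> links S" | "(b, c) = (u, v)" | "(b, c) = (v, u)"
      using assms(1) by auto
    then show ?case
    proof cases
      case 1
      then show ?thesis using step.IH by (meson rtrancl.rtrancl_into_rtrancl)
    next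
      case 2
      then show ?thesis using step.IH links_sym by (metis Pair_inject rtrancl.rtrancl_refl rtrancl_trans)
    next
      case 3
      then show ?thesis using step.IH links_sym by (metis Pair_inject rtrancl.rtrancl_refl rtrancl_trans)
    qed
  qed simp
  then show ?thesis by blast
qed

text \<open>An edge merges at most two classes. With the class of one end \<open>u\<close> left out,
  sending old classes to new ones becomes injective.\<close>

lemma num_components_insert:
  assumes "e \<in> edges G"
  shows "num_components G S \<le> Suc (num_components G (insert e S))"
proof -
  obtain u v where uv: "ends G e = (u, v)" by fastforce
  have u: "u \<in> verts G" using uv ends_in_verts assms by force
  let ?R = "connection G S" and ?R' = "connection G (insert e S)"
  let ?U = "?R `` {u}"
  have "inj_on (\<lambda>X. ?R' `` X) (verts G // ?R - {?U})"
  proof (rule inj_onI)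
    fix X Y assume XY: "X \<in> verts G // ?R - {?U}" "Y \<in> verts G // ?R - {?U}" "?R' `` X = ?R' `` Y"
    obtain a where a: "a \<in> verts G" "X = ?R `` {a}" using XY(1) by (auto elim: quotientE)
    obtain b where b: "b \<in> verts G" "Y = ?R `` {b}" using XY(2) by (auto elim: quotientE)
    have "b \<in> Y" using b by (auto simp: connection_def)
    then have "b \<in> ?R' `` X" using b XY(3) by (auto simp: connection_def)
    then obtain a' where "(a, a') \<in> ?R" "(a', b) \<in> ?R'" using a by auto
    then have "(a, b) \<in> ?R'"
      using connection_mono[of S "insert e S"] equiv_connection[of "insert e S"]
      by (auto elim!: equivE dest: transD)
    then have "(a, b) \<in> ?R \<or> (a, u) \<in> ?R \<or> (u, b) \<in> ?R"
      using links_insert_path[OF uv, of a b S] a b u by (auto simp: connection_def)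
    then have "X = Y \<or> X = ?U \<or> ?U = Y"
      using equiv_class_eq[OF equiv_connection] a b by metis
    then show "X = Y" using XY by auto
  qed
  moreover have "(\<lambda>X. ?R' `` X) ` (verts G // ?R - {?U}) \<subseteq> verts G // ?R'"
  proof (rule image_subsetI)
    fix X assume "X \<in> verts G // ?R - {?U}"
    then obtain a where a: "a \<in> verts G" "X = ?R `` {a}" by (auto elim: quotientE)
    have "?R' `` X = ?R' `` {a}"
      using connection_Image_class[OF subset_insertI a(1)] a(2) by simp
    then show "?R' `` X \<in> verts G // ?R'" using a by (metis quotientI)
  qed
  ultimately have "card (verts G // ?R - {?U}) \<le> card (verts G // ?R')"
    by (rule card_inj_on_le) simp
  then show ?thesis
    using quotientI[OF u, of ?R] by (simp add: num_components_def card_Diff_singleton)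
qed

lemma num_components_empty: "num_components G {} = card (verts G)"
proof -
  have "verts G // connection G {} = (\<lambda>v. {v}) ` verts G"
    by (auto simp: connection_def quotient_def)
  then show ?thesis by (simp add: num_components_def card_image)
qed

lemma card_verts_le:
  assumes "S \<subseteq> edges G"
  shows "card (verts G) \<le> num_components G S + card S"
  using finite_subset[OF assms finite_edges] assms
proof (induction rule: finite_induct)
  case (insert e S)
  then show ?case using num_components_insert[of e S] by simp
qed (simp add: num_components_empty)

section \<open>Colourings and the expansion over edge subsets\<close>

lemma card_colourings:
  fixes C :: "'c set"
  assumes "S \<subseteq> edges G"
  shows "card {\<sigma> \<in> verts G \<rightarrow>\<^sub>E C. \<forall>e\<in>S. \<sigma> (fst (ends G e)) = \<sigma> (snd (ends G e))} =
    card C ^ num_components G S" (is "card ?M = _")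
proof -
  let ?R = "connection G S"
  \<comment> \<open>A colouring that agrees along all edges of \<open>S\<close> is constant on
    components; \<open>\<Phi>\<close> pulls a function on the components back to the
    vertices.\<close>
  define \<Phi> where "\<Phi> = (\<lambda>\<tau>. \<lambda>v\<in>verts G. \<tau> (?R `` {v}) :: 'c)"
  have "bij_betw \<Phi> (verts G // ?R \<rightarrow>\<^sub>E C) ?M"
  proof (rule bij_betw_imageI)
    show "inj_on \<Phi> (verts G // ?R \<rightarrow>\<^sub>E C)"
    proof (rule inj_onI)
      fix \<tau> \<tau>' assume t: "\<tau> \<in> verts G // ?R \<rightarrow>\<^sub>E C" "\<tau>' \<in> verts G // ?R \<rightarrow>\<^sub>E C" "\<Phi> \<tau> = \<Phi> \<tau>'"
      have "\<tau> X = \<tau>' X" if "X \<in> verts G // ?R" for X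
      proof -
        from that obtain v where "v \<in> verts G" "X = ?R `` {v}" by (rule quotientE)
        with fun_cong[OF t(3), of v] show ?thesis by (simp add: \<Phi>_def)
      qed
      then show "\<tau> = \<tau>'" using t by (intro PiE_ext)
    qed
    show "\<Phi> ` (verts G // ?R \<rightarrow>\<^sub>E C) = ?M"
    proof (intro equalityI image_subsetI subsetI)
      fix \<tau> assume t: "\<tau> \<in> verts G // ?R \<rightarrow>\<^sub>E C"
      then have "\<Phi> \<tau> \<in> verts G \<rightarrow>\<^sub>E C" by (auto simp: \<Phi>_def intro: quotientI)
      moreover have "\<Phi> \<tau> (fst (ends G e)) = \<Phi> \<tau> (snd (ends G e))" if e: "e \<in> S" for e
      proof -
        have v: "fst (ends G e) \<in> verts G" "snd (ends G e) \<in> verts G"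
          using e ends_in_verts assms(1) by force+
        then have "(fst (ends G e), snd (ends G e)) \<in> ?R"
          using e by (simp add: connection_def case_prod_unfold r_into_rtrancl)
        then have "?R `` {fst (ends G e)} = ?R `` {snd (ends G e)}"
          by (rule equiv_class_eq[OF equiv_connection])
        then show ?thesis using v by (simp add: \<Phi>_def)
      qed
      ultimately show "\<Phi> \<tau> \<in> ?M" by simp
    next
      fix \<sigma> assume "\<sigma> \<in> ?M"
      then have s: "\<sigma> \<in> verts G \<rightarrow>\<^sub>E C" "\<forall>e\<in>S. \<sigma> (fst (ends G e)) = \<sigma> (snd (ends G e))"
        by simp_all
      have const: "\<sigma> u = \<sigma> v" if "(u, v) \<in> ?R" for u v
      proof -
        from that have "(u, v) \<in> (links S)\<^sup>*" by (simp add: connection_def)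
        then show ?thesis
        proof induction
          case (step b c)
          have "\<sigma> b = \<sigma> c" using step.hyps(2) s(2) by (metis Un_iff converseD fst_conv imageE snd_conv)
          with step.IH show ?case by simp
        qed simp
      qed
      \<comment> \<open>The value does not depend on the chosen representative, since by
        \<open>const\<close> the colouring \<open>\<sigma>\<close> is constant on each
        class.\<close>
      define \<tau> where "\<tau> = (\<lambda>X\<in>verts G // ?R. \<sigma> (SOME v. v \<in> X))"
      have some: "(v, SOME w. w \<in> ?R `` {v}) \<in> ?R" if "v \<in> verts G" for v
        using someI[of "\<lambda>w. w \<in> ?R `` {v}" v] that by (auto simp: connection_def)
      have val: "\<tau> (?R `` {v}) = \<sigma> v" if "v \<in> verts G" for v
        using that const[OF some[OF that]] by (simp add: \<tau>_def quotientI)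
      have "\<tau> \<in> verts G // ?R \<rightarrow>\<^sub>E C"
      proof
        fix X assume "X \<in> verts G // ?R"
        then obtain v where "v \<in> verts G" "X = ?R `` {v}" by (rule quotientE)
        then show "\<tau> X \<in> C" using val s(1) by auto
      qed (simp add: \<tau>_def)
      moreover have "\<Phi> \<tau> = \<sigma>"
        using s(1) val by (auto simp: \<Phi>_def fun_eq_iff PiE_def extensional_def)
      ultimately show "\<sigma> \<in> \<Phi> ` (verts G // ?R \<rightarrow>\<^sub>E C)" by blast
    qed
  qed
  from bij_betw_same_card[OF this] show ?thesis by (simp add: card_PiE num_components_def)
qed

text \<open>Fortuin-Kasteleyn expansion: write each edge factor as \<open>1\<close> plus either
  \<open>y - 1\<close> or \<open>0\<close>, multiply out, exchange the sums, and count the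
  colourings that are constant on the components of \<open>S\<close>.\<close>

lemma potts_expansion:
  fixes C :: "'c set"
  assumes "finite C"
  shows "potts G C (y :: 'a::comm_ring_1) =
    (\<Sum>S\<in>Pow (edges G). of_nat (card C) ^ num_components G S * (y - 1) ^ card S)"
proof -
  let ?mono = "\<lambda>\<sigma> e. \<sigma> (fst (ends G e)) = \<sigma> (snd (ends G e))"
  have fin: "finite (verts G \<rightarrow>\<^sub>E C)" using assms by (simp add: finite_PiE)
  have "(\<Prod>e\<in>edges G. if ?mono \<sigma> e then y else 1) =
      (\<Sum>S\<in>Pow (edges G). if \<forall>e\<in>S. ?mono \<sigma> e then (y - 1) ^ card S else 0)" for \<sigma> :: "'v \<Rightarrow> 'c"
  proof -
    have "(\<Prod>e\<in>edges G. if ?mono \<sigma> e then y else 1) =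
        (\<Prod>e\<in>edges G. (if ?mono \<sigma> e then y - 1 else 0) + 1)"
      by (intro prod.cong) auto
    also have "\<dots> = (\<Sum>S\<in>Pow (edges G). \<Prod>e\<in>S. if ?mono \<sigma> e then y - 1 else 0)"
      by (simp add: prod_add)
    also have "\<dots> = (\<Sum>S\<in>Pow (edges G). if \<forall>e\<in>S. ?mono \<sigma> e then (y - 1) ^ card S else 0)"
      by (intro sum.cong refl) (auto simp: finite_subset[OF _ finite_edges] intro!: prod_zero)
    finally show ?thesis .
  qed
  then have "potts G C y = (\<Sum>S\<in>Pow (edges G). \<Sum>\<sigma>\<in>verts G \<rightarrow>\<^sub>E C.
      if \<forall>e\<in>S. ?mono \<sigma> e then (y - 1) ^ card S else 0)"
    unfolding potts_def by (subst sum.swap) simp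
  also have "\<dots> = (\<Sum>S\<in>Pow (edges G).
      of_nat (card {\<sigma> \<in> verts G \<rightarrow>\<^sub>E C. \<forall>e\<in>S. ?mono \<sigma> e}) * (y - 1) ^ card S)"
    using fin by (intro sum.cong refl) (simp add: sum.If_cases Int_def)
  also have "\<dots> = (\<Sum>S\<in>Pow (edges G). of_nat (card C) ^ num_components G S * (y - 1) ^ card S)"
    using assms by (intro sum.cong refl) (simp add: card_colourings)
  finally show ?thesis .
qed

text \<open>Writing \<open>card C\<close> as \<open>(x - 1) * (y - 1)\<close> gives the terms of the
  expansion the exponents \<open>c(S)\<close> and \<open>c(S) + |S|\<close>. Their lower bounds
  \<open>c(E)\<close> and \<open>|V|\<close> are factored out, so no division occurs.\<close>

lemma potts_eq_tutte:
  assumes "finite C" "(x - 1) * (y - 1) = (of_nat (card C) :: 'a::comm_ring_1)"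
  shows "potts G C y =
    (x - 1) ^ num_components G (edges G) * (y - 1) ^ card (verts G) * tutte G x y"
  unfolding potts_expansion[OF assms(1)] tutte_def sum_distrib_left
proof (intro sum.cong refl)
  fix S assume "S \<in> Pow (edges G)"
  \<comment> \<open>These bounds make both truncated subtractions in \<open>tutte\<close>
    exact.\<close>
  then have "num_components G (edges G) \<le> num_components G S"
    "card (verts G) \<le> num_components G S + card S"
    by (auto intro: num_components_antimono card_verts_le)
  then obtain p q where pq: "num_components G S = num_components G (edges G) + p"
    "num_components G S + card S = card (verts G) + q"
    by (auto simp: le_iff_add)
  have "of_nat (card C) ^ num_components G S * (y - 1) ^ card S =
      (x - 1) ^ num_components G S * (y - 1) ^ (num_components G S + card S)"
    by (simp add: assms(2)[symmetric] power_mult_distrib power_add mult.assoc)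
  \<comment> \<open>\<open>pq(2)\<close> has to be applied first: \<open>pq(1)\<close> would rewrite
    the component count inside its left side.\<close>
  also have "\<dots> = (x - 1) ^ (num_components G (edges G) + p) * (y - 1) ^ (card (verts G) + q)"
    by (simp only: pq(2)) (simp only: pq(1))
  also have "\<dots> = (x - 1) ^ num_components G (edges G) * (y - 1) ^ card (verts G) *
      ((x - 1) ^ (num_components G S - num_components G (edges G)) *
       (y - 1) ^ (num_components G S + card S - card (verts G)))"
    using pq by (simp add: power_add mult_ac)
  finally show "of_nat (card C) ^ num_components G S * (y - 1) ^ card S =
      (x - 1) ^ num_components G (edges G) * (y - 1) ^ card (verts G) *
      ((x - 1) ^ (num_components G S - num_components G (edges G)) *
       (y - 1) ^ (num_components G S + card S - card (verts G)))" .
qed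

end

section \<open>The partition function of a tree diagram\<close>

lemma half_edges_bounds:
  "e \<in> half_edges s T \<Longrightarrow> s \<le> fst e \<and> fst e < snd e \<and> snd e < s + leaves T"
proof (induction T arbitrary: s)
  case (Nd l r)
  then show ?case
    using leaves_pos[of l] leaves_pos[of r] by (fastforce simp del: leaves_pos)
qed simp

lemma finite_half_edges [simp]: "finite (half_edges s T)"
  by (induction T arbitrary: s) auto

text \<open>With edges directed to the right, \<open>s\<close> reaches the block of the left subtree
  by induction; the root edge leads to \<open>s + leaves l\<close>, the first vertex of the right
  block.\<close>

lemma half_edges_reachable:
  assumes "k < leaves T"
  shows "(s, s + k) \<in> (half_edges s T)\<^sup>*"
  using assms
proof (induction T arbitrary: s k)
  case (Nd l r)
  show ?case
  proof (cases "k < leaves l")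
    case True
    then show ?thesis
      using Nd.IH(1)[OF True, of s] rtrancl_mono[of "half_edges s l" "half_edges s (Nd l r)"] by auto
  next
    case False
    then have "(s + leaves l, s + k) \<in> (half_edges (s + leaves l) r)\<^sup>*"
      using Nd.IH(2)[of "k - leaves l" "s + leaves l"] Nd.prems by simp
    then have "(s + leaves l, s + k) \<in> (half_edges s (Nd l r))\<^sup>*"
      using rtrancl_mono[of "half_edges (s + leaves l) r" "half_edges s (Nd l r)"] by auto
    moreover have "(s, s + leaves l) \<in> half_edges s (Nd l r)" by simp
    ultimately show ?thesis by (rule converse_rtrancl_into_rtrancl[rotated])
  qed
qed simp

lemma verts_tree_graph [simp]: "verts (tree_graph A B) = {0..<leaves A}"
  by (simp add: tree_graph_def)

lemma finite_multigraph_tree_graph: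
  assumes "leaves A = leaves B"
  shows "finite_multigraph (tree_graph A B)"
proof
  show "ends (tree_graph A B) ` edges (tree_graph A B)
      \<subseteq> verts (tree_graph A B) \<times> verts (tree_graph A B)"
    using assms half_edges_bounds[of _ 0 A] half_edges_bounds[of _ 0 B]
    by (fastforce simp: tree_graph_def)
qed (auto simp: tree_graph_def)

text \<open>The upper half alone already joins every vertex to \<open>0\<close>.\<close>

lemma num_components_tree_graph:
  assumes "leaves A = leaves B"
  shows "num_components (tree_graph A B) (edges (tree_graph A B)) = 1"
proof -
  let ?G = "tree_graph A B"
  interpret finite_multigraph ?G by (rule finite_multigraph_tree_graph[OF assms])
  have "half_edges 0 A \<subseteq> links (edges ?G)"
  proof
    fix e assume "e \<in> half_edges 0 A"
    then have "ends ?G (Inl e) \<in> ends ?G ` edges ?G"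
      by (intro imageI) (auto simp: tree_graph_def)
    then show "e \<in> links (edges ?G)" by (simp add: tree_graph_def)
  qed
  then have from_0: "(0, k) \<in> (links (edges ?G))\<^sup>*" if "k < leaves A" for k
    using half_edges_reachable[OF that, of 0] subsetD[OF rtrancl_mono] by simp
  have "(j, k) \<in> (links (edges ?G))\<^sup>*" if "j < leaves A" "k < leaves A" for j k
    using links_sym[OF from_0[OF that(1)]] from_0[OF that(2)] by (rule rtrancl_trans)
  then have "(j, k) \<in> connection ?G (edges ?G) \<longleftrightarrow> j < leaves A \<and> k < leaves A" for j k
    unfolding connection_def by simp blast
  then have "connection ?G (edges ?G) `` {v} = verts ?G" if "v \<in> verts ?G" for v
    using that by (simp add: set_eq_iff)
  then have "verts ?G // connection ?G (edges ?G) = (\<Union>v\<in>verts ?G. {verts ?G})"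
    unfolding quotient_def by (intro SUP_cong refl) simp
  also have "\<dots> = {verts ?G}"
    using leaves_pos[of A] by auto
  finally show ?thesis by (simp add: num_components_def)
qed

text \<open>The coordinate at \<open>\<sigma>\<close> of the vector attached to a tree. The offset
  \<open>s\<close> lets subtrees read the same colouring on their own blocks of vertices.\<close>

fun tree_weight :: "'a::comm_ring_1 \<Rightarrow> nat \<Rightarrow> btree \<Rightarrow> (nat \<Rightarrow> 'c) \<Rightarrow> 'a" where
  "tree_weight y s Lf \<sigma> = 1"
| "tree_weight y s (Nd l r) \<sigma> = (if \<sigma> s = \<sigma> (s + leaves l) then y else 1) *
     tree_weight y s l \<sigma> * tree_weight y (s + leaves l) r \<sigma>"

text \<open>The root edge and the edges of the two subtrees are pairwise distinct, so a product over
  the edge set loses no factor.\<close>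

lemma prod_half_edges:
  "(\<Prod>e\<in>half_edges s T. if \<sigma> (fst e) = \<sigma> (snd e) then y else 1) = tree_weight y s T \<sigma>"
proof (induction T arbitrary: s)
  case (Nd l r)
  have "(s, s + leaves l) \<notin> half_edges s l" "(s, s + leaves l) \<notin> half_edges (s + leaves l) r"
    using half_edges_bounds[of "(s, s + leaves l)" s l]
      half_edges_bounds[of "(s, s + leaves l)" "s + leaves l" r] leaves_pos[of l]
    by (auto simp del: leaves_pos)
  moreover have "half_edges s l \<inter> half_edges (s + leaves l) r = {}"
    using half_edges_bounds[of _ s l] half_edges_bounds[of _ "s + leaves l" r] by fastforce
  ultimately show ?case by (simp add: prod.union_disjoint Nd mult.assoc)
qed simp

lemma potts_tree_graph:
  "potts (tree_graph A B) C y =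
    (\<Sum>\<sigma>\<in>{0..<leaves A} \<rightarrow>\<^sub>E C. tree_weight y 0 A \<sigma> * tree_weight y 0 B \<sigma>)"
  by (simp add: potts_def tree_graph_def prod.Plus prod_half_edges)

section \<open>Effect of opposite carets on the partition function\<close>

lemma tree_weight_cong:
  assumes "\<And>i. i < leaves T \<Longrightarrow> \<sigma> (s + i) = \<tau> (t + i)"
  shows "tree_weight y s T \<sigma> = tree_weight y t T \<tau>"
  using assms
proof (induction T arbitrary: s t)
  case (Nd l r)
  have "tree_weight y (s + leaves l) r \<sigma> = tree_weight y (t + leaves l) r \<tau>"
    using Nd.prems by (intro Nd.IH) (simp add: add.assoc)
  moreover have "tree_weight y s l \<sigma> = tree_weight y t l \<tau>"
    using Nd.prems by (intro Nd.IH) simp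
  ultimately show ?case using Nd.prems[of 0] Nd.prems[of "leaves l"] by simp
qed simp

text \<open>Inserting a new vertex \<open>p\<close> renumbers the old vertex \<open>i\<close> as \<open>skip p i\<close>.\<close>

definition skip :: "nat \<Rightarrow> nat \<Rightarrow> nat" where
  "skip p i = (if i < p then i else Suc i)"

lemma skip_less [simp]: "i < p \<Longrightarrow> skip p i = i"
  and skip_ge [simp]: "p \<le> i \<Longrightarrow> skip p i = Suc i"
  by (simp_all add: skip_def)

text \<open>The caret at leaf index \<open>k\<close>, counted from 0, contributes the edge from
  \<open>s + k\<close> to the new vertex \<open>s + Suc k\<close>; every other edge keeps its ends
  up to renumbering.\<close>

lemma tree_weight_add_caret:
  assumes "k < leaves T"
  shows "tree_weight y s (add_caret k T) \<sigma> =
    (if \<sigma> (s + k) = \<sigma> (s + Suc k) then y else 1) * tree_weight y s T (\<sigma> \<circ> skip (s + Suc k))"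
  using assms
proof (induction T arbitrary: s k)
  case (Nd l r)
  show ?case
  proof (cases "k < leaves l")
    case True
    \<comment> \<open>The right block starts after the new vertex, so all its indices move by
      one.\<close>
    have "tree_weight y (Suc (s + leaves l)) r \<sigma>
        = tree_weight y (s + leaves l) r (\<sigma> \<circ> skip (s + Suc k))"
      using True by (intro tree_weight_cong) simp
    then show ?thesis using True Nd.IH(1)[OF True, of s]
      by (simp add: comp_def mult_ac)
  next
    case False
    have "tree_weight y s l \<sigma> = tree_weight y s l (\<sigma> \<circ> skip (s + Suc k))"
      using False by (intro tree_weight_cong) simp
    then show ?thesis using False Nd.IH(2)[of "k - leaves l" "s + leaves l"] Nd.prems
      by (simp add: comp_def mult_ac)
  qed
qed simp

text \<open>A colouring of \<open>Suc n\<close> vertices amounts to the colour \<open>c\<close> of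
  vertex \<open>p\<close> together with a colouring of the others, renumbered without a gap.\<close>

lemma sum_PiE_skip:
  assumes "p \<le> n"
  shows "(\<Sum>\<sigma>\<in>{0..<Suc n} \<rightarrow>\<^sub>E C. F (restrict (\<sigma> \<circ> skip p) {0..<n}) (\<sigma> p)) =
    (\<Sum>\<tau>\<in>{0..<n} \<rightarrow>\<^sub>E C. \<Sum>c\<in>C. F \<tau> c)"
  unfolding sum.cartesian_product
  by (rule sum.reindex_bij_witness[of _
      "\<lambda>(\<tau>, c). \<lambda>i\<in>{0..<Suc n}. if i < p then \<tau> i else if i = p then c else \<tau> (i - 1)"
      "\<lambda>\<sigma>. (restrict (\<sigma> \<circ> skip p) {0..<n}, \<sigma> p)"])
    (use assms in \<open>auto simp: skip_def PiE_def Pi_def extensional_def fun_eq_iff\<close>)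

text \<open>The colour \<open>c = a\<close> gives \<open>y^2\<close>, and each of the other
  \<open>card C - 1\<close> colours gives \<open>1\<close>.\<close>

lemma sum_Potts_weight_square:
  assumes "finite C" "a \<in> C"
  shows "(\<Sum>c\<in>C. (if a = c then y else 1) * (if a = c then y else 1)) =
    (y^2 + of_nat (card C) - 1 :: 'a::comm_ring_1)"
proof -
  have "(\<Sum>c\<in>C. (if a = c then y else 1) * (if a = c then y else 1)) =
      (\<Sum>c\<in>C. (if a = c then y^2 - 1 else 0) + 1)"
    by (intro sum.cong) (auto simp: power2_eq_square)
  also have "\<dots> = y^2 + of_nat (card C) - 1"
    using assms by (simp add: sum.distrib)
  finally show ?thesis .
qed

lemma potts_add_caret:
  fixes C :: "'c set" and y :: "'a::comm_ring_1"
  assumes "leaves A = leaves B" "k < leaves B" "finite C"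
  shows "potts (tree_graph (add_caret k A) (add_caret k B)) C y =
    (y^2 + of_nat (card C) - 1) * potts (tree_graph A B) C y"
proof -
  define n where "n = leaves B"
  let ?w = "\<lambda>T. tree_weight y 0 T :: (nat \<Rightarrow> 'c) \<Rightarrow> 'a"
  let ?f = "\<lambda>a b :: 'c. if a = b then y else 1"
  \<comment> \<open>Restricting the old colours to \<open>{0..<n}\<close> produces the shape that
    \<open>sum_PiE_skip\<close> expects; the weight of \<open>T\<close> reads only these indices,
    and \<open>skip (Suc k)\<close> fixes \<open>k\<close>.\<close>
  have w: "?w (add_caret k T) \<sigma> =
      ?f (restrict (\<sigma> \<circ> skip (Suc k)) {0..<n} k) (\<sigma> (Suc k)) *
      ?w T (restrict (\<sigma> \<circ> skip (Suc k)) {0..<n})"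
    if "leaves T = n" for T \<sigma>
  proof -
    have "?w T (\<sigma> \<circ> skip (Suc k)) = ?w T (restrict (\<sigma> \<circ> skip (Suc k)) {0..<n})"
      using that by (intro tree_weight_cong) simp
    then show ?thesis
      using tree_weight_add_caret[of k T y 0 \<sigma>] that assms(2) by (simp add: n_def)
  qed
  have "potts (tree_graph (add_caret k A) (add_caret k B)) C y =
      (\<Sum>\<sigma>\<in>{0..<Suc n} \<rightarrow>\<^sub>E C.
        (\<lambda>\<tau> c. (?f (\<tau> k) c * ?w A \<tau>) * (?f (\<tau> k) c * ?w B \<tau>))
          (restrict (\<sigma> \<circ> skip (Suc k)) {0..<n}) (\<sigma> (Suc k)))"
    using assms by (simp add: potts_tree_graph w n_def)
  also have "\<dots> = (\<Sum>\<tau>\<in>{0..<n} \<rightarrow>\<^sub>E C. \<Sum>c\<in>C. (?f (\<tau> k) c * ?w A \<tau>) * (?f (\<tau> k) c * ?w B \<tau>))"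
    using assms by (intro sum_PiE_skip) (simp add: n_def)
  also have "\<dots> = (\<Sum>\<tau>\<in>{0..<n} \<rightarrow>\<^sub>E C. (\<Sum>c\<in>C. ?f (\<tau> k) c * ?f (\<tau> k) c) * (?w A \<tau> * ?w B \<tau>))"
    unfolding sum_distrib_right by (intro sum.cong refl) (simp only: mult_ac)
  also have "\<dots> = (\<Sum>\<tau>\<in>{0..<n} \<rightarrow>\<^sub>E C. (y^2 + of_nat (card C) - 1) * (?w A \<tau> * ?w B \<tau>))"
    using assms by (intro sum.cong refl) (subst sum_Potts_weight_square, auto simp: n_def)
  also have "\<dots> = (y^2 + of_nat (card C) - 1) * potts (tree_graph A B) C y"
    using assms by (simp add: potts_tree_graph sum_distrib_left n_def)
  finally show ?thesis .
qed

text \<open>Each opposite pair of carets contributes one factor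
  \<open>y^2 + of_nat (card X) - 1\<close>. Powers on both sides express the ratio without
  division.\<close>

lemma refines_potts:
  assumes "refines B C" "leaves A = leaves B" "finite X"
  shows "\<exists>A'. leaves A' = leaves C \<and> tree_map A' C = tree_map A B \<and>
    (y^2 + of_nat (card X) - 1) ^ leaves B * potts (tree_graph A' C) X y =
    (y^2 + of_nat (card X) - 1) ^ leaves C * potts (tree_graph A B) X y"
  using assms
proof induction
  case (refines_caret T k)
  then obtain A' where "leaves A' = leaves T" "tree_map A' T = tree_map A B"
    "(y^2 + of_nat (card X) - 1) ^ leaves B * potts (tree_graph A' T) X y =
    (y^2 + of_nat (card X) - 1) ^ leaves T * potts (tree_graph A B) X y" by blast
  then show ?case using tree_map_add_caret[of A' T k] potts_add_caret[of A' T k X y] refines_caret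
    by (intro exI[of _ "add_caret k A'"]) (simp add: mult.left_commute mult.assoc)
qed auto

section \<open>Positivity\<close>

text \<open>Both denominators are refined to one complete tree, over which the numerators coincide
  by \<open>tree_map_inj\<close>. So the normalised partition function depends on the group element
  alone.\<close>

lemma potts_tree_map_eq:
  fixes y :: real
  assumes "leaves A = leaves B" "leaves A' = leaves B'" "tree_map A B = tree_map A' B'"
    and "finite X" "y^2 + real (card X) - 1 \<noteq> 0"
  shows "potts (tree_graph A B) X y / (y^2 + real (card X) - 1) ^ leaves B =
    potts (tree_graph A' B') X y / (y^2 + real (card X) - 1) ^ leaves B'"
proof -
  define C where "C = full_tree (max (depth B) (depth B'))"
  define c where "c = y^2 + real (card X) - 1"
  have "refines B C" "refines B' C"
    unfolding C_def by (auto intro: refines_full_tree)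
  obtain A1 where A1: "leaves A1 = leaves C" "tree_map A1 C = tree_map A B"
    "c ^ leaves B * potts (tree_graph A1 C) X y = c ^ leaves C * potts (tree_graph A B) X y"
    using refines_potts[OF \<open>refines B C\<close> assms(1,4), of y] by (auto simp: c_def)
  obtain A2 where A2: "leaves A2 = leaves C" "tree_map A2 C = tree_map A' B'"
    "c ^ leaves B' * potts (tree_graph A2 C) X y = c ^ leaves C * potts (tree_graph A' B') X y"
    using refines_potts[OF \<open>refines B' C\<close> assms(2,4), of y] by (auto simp: c_def)
  have "A1 = A2"
    using A1 A2 assms(3) by (intro tree_map_inj[of A1 C A2]) auto
  have "c \<noteq> 0" using assms(5) by (simp add: c_def)
  then have "potts (tree_graph A B) X y / c ^ leaves B = potts (tree_graph A1 C) X y / c ^ leaves C"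
    using A1(3) by (simp add: field_simps)
  moreover have "potts (tree_graph A' B') X y / c ^ leaves B' =
      potts (tree_graph A2 C) X y / c ^ leaves C"
    using A2(3) \<open>c \<noteq> 0\<close> by (simp add: field_simps)
  ultimately show ?thesis using \<open>A1 = A2\<close> by (simp add: c_def)
qed

text \<open>\<open>SOME\<close> selects an unknown pair \<open>(S, T)\<close>; its value is computed
  and then carried over to \<open>(A, B)\<close> by \<open>potts_tree_map_eq\<close>. The powers of
  \<open>y - 1\<close> cancel, so the remaining constant is positive for either sign of
  \<open>y - 1\<close>.\<close>

lemma thompson_tutte_tree_map:
  fixes Q :: nat and x y :: real
  assumes "Q \<ge> 1" "y > 0" "y \<noteq> 1" "x = (y + real Q - 1) / (y - 1)" "leaves A = leaves B"
  shows "thompson_tutte x y (tree_map A B) =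
    potts (tree_graph A B) {..<Q} y / (real Q * (y^2 + real Q - 1) ^ (leaves A - 1))"
proof -
  let ?c = "y^2 + real Q - 1"
  have "?c > 0" using assms(1,2) by (smt (verit) of_nat_1 of_nat_mono zero_less_power)
  have xy: "(x - 1) * (y - 1) = real (card {..<Q})" "x + y = ?c / (y - 1)"
    using assms(3) by (simp_all add: assms(4) field_simps power2_eq_square)
  have val: "tutte (tree_graph S T) x y * (x + y) powi (1 - int (leaves S)) =
      potts (tree_graph S T) {..<Q} y / (real Q * ?c ^ (leaves S - 1))"
    if "leaves S = leaves T" for S T
  proof -
    interpret finite_multigraph "tree_graph S T" by (rule finite_multigraph_tree_graph[OF that])
    obtain m where m: "leaves S = Suc m" using leaves_pos[of S] gr0_implies_Suc by blast
    \<comment> \<open>The graph is connected with \<open>m + 1\<close> vertices, so the single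
      factor \<open>x - 1\<close> and one factor \<open>y - 1\<close> combine to
      \<open>Q\<close>.\<close>
    have "potts (tree_graph S T) {..<Q} y = real Q * (y - 1) ^ m * tutte (tree_graph S T) x y"
      using potts_eq_tutte[OF _ xy(1)] xy(1) num_components_tree_graph[OF that] m
      by (simp add: mult_ac)
    moreover have "(x + y) powi (1 - int (leaves S)) = (y - 1) ^ m / ?c ^ m"
      by (simp add: m xy(2) power_int_minus power_divide)
    ultimately show ?thesis using assms(1) by (simp add: m)
  qed
  have "\<exists>v T1 T2. leaves T1 = leaves T2 \<and> tree_map A B = tree_map T1 T2 \<and>
     v = tutte (tree_graph T1 T2) x y * (x + y) powi (1 - int (leaves T1))"
    using assms(5) by blast
  from someI_ex[OF this] obtain S T where ST: "leaves S = leaves T" "tree_map A B = tree_map S T"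
    "thompson_tutte x y (tree_map A B) =
      tutte (tree_graph S T) x y * (x + y) powi (1 - int (leaves S))"
    unfolding thompson_tutte_def by blast
  have "potts (tree_graph S T) {..<Q} y / ?c ^ leaves S =
      potts (tree_graph A B) {..<Q} y / ?c ^ leaves A"
    using potts_tree_map_eq[OF ST(1) assms(5) ST(2)[symmetric], of "{..<Q}" y] \<open>?c > 0\<close> ST(1) assms(5)
    by simp
  \<comment> \<open>Passes between the exponent \<open>leaves U\<close> of
    \<open>potts_tree_map_eq\<close> and the exponent \<open>leaves U - 1\<close> of the
    normalisation; the factor \<open>c / real Q\<close> is the same for both pairs.\<close>
  moreover have "X / (real Q * c ^ (leaves U - 1)) = c / real Q * (X / c ^ leaves U)"
    if "c \<noteq> 0" for X c U
    using that power_minus_mult[OF leaves_pos, of c U, symmetric] by simp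
  ultimately show ?thesis using ST(3) val[OF ST(1)] \<open>?c > 0\<close> by (metis less_irrefl)
qed

text \<open>Exchanging the sums turns the quadratic form into \<open>d\<close> times the sum over
  \<open>s\<close> of the squared moduli of \<open>?V s\<close>, the combination of the vectors with
  coefficients \<open>c j\<close>.\<close>

lemma pos_semidef_gram:
  fixes v :: "nat \<Rightarrow> 'i \<Rightarrow> real"
  assumes "d \<ge> 0" "\<And>i j. i < r \<Longrightarrow> j < r \<Longrightarrow> M i j = complex_of_real (d * (\<Sum>s\<in>A. v i s * v j s))"
  shows "pos_semidef r M"
  unfolding pos_semidef_def
proof (intro conjI allI impI)
  fix i j assume "i < r" "j < r"
  then show "M j i = cnj (M i j)" by (simp add: assms(2) mult.commute)
next
  fix c :: "nat \<Rightarrow> complex"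
  let ?V = "\<lambda>s. \<Sum>j<r. c j * v j s"
  have norm_square: "cnj z * z = complex_of_real ((cmod z)\<^sup>2)" for z
    by (subst complex_norm_square) (rule mult.commute)
  have "(\<Sum>i<r. \<Sum>j<r. cnj (c i) * M i j * c j) =
      (\<Sum>i<r. \<Sum>j<r. \<Sum>s\<in>A. of_real d * (cnj (c i * v i s) * (c j * v j s)))"
    by (intro sum.cong refl) (simp add: assms(2) sum_distrib_left sum_distrib_right mult_ac)
  also have "\<dots> = (\<Sum>s\<in>A. \<Sum>i<r. \<Sum>j<r. of_real d * (cnj (c i * v i s) * (c j * v j s)))"
    by (simp add: sum.swap[of _ A])
  also have "\<dots> = (\<Sum>s\<in>A. of_real d * (cnj (?V s) * ?V s))"
    unfolding cnj_sum sum_product by (simp only: sum_distrib_left)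
  also have "\<dots> = complex_of_real (\<Sum>s\<in>A. d * (cmod (?V s))\<^sup>2)"
    by (simp only: norm_square of_real_sum of_real_mult)
  also have "\<dots> \<in> \<real>\<^sub>\<ge>\<^sub>0"
    unfolding nonneg_Reals_of_real_iff
    using assms(1) by (intro sum_nonneg mult_nonneg_nonneg) simp_all
  finally show "(\<Sum>i<r. \<Sum>j<r. cnj (c i) * M i j * c j) \<in> \<real>\<^sub>\<ge>\<^sub>0" .
qed

theorem theorem4p2:
  fixes Q :: nat and K x y :: real
  assumes "Q \<ge> 1" and "K \<noteq> 0"
    and "y = exp K" and "x = (y + real Q - 1) / (y - 1)"
  shows "positive_type thompson_F (\<lambda>g. complex_of_real (thompson_tutte x y g))"
  unfolding positive_type_def
proof (intro allI impI)
  fix r and g :: "nat \<Rightarrow> real \<Rightarrow> real"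
  assume g: "\<forall>i<r. g i \<in> carrier thompson_F"
  have y: "y > 0" "y \<noteq> 1" using assms(2,3) by auto
  obtain C where "\<And>h. h \<in> g ` {..<r} \<Longrightarrow> \<exists>A. leaves A = leaves C \<and> h = tree_map A C"
    by (rule thompson_F_common_denominator[of "g ` {..<r}"]) (use g in auto)
  then have "\<forall>i<r. \<exists>A. leaves A = leaves C \<and> g i = tree_map A C" by auto
  then obtain A where A: "\<And>i. i < r \<Longrightarrow> leaves (A i) = leaves C" "\<And>i. i < r \<Longrightarrow> g i = tree_map (A i) C"
    by metis
  \<comment> \<open>All trees \<open>A i\<close> have as many leaves as \<open>C\<close>, so one
    scalar serves every entry of the Gram matrix.\<close>
  let ?c = "1 / (real Q * (y^2 + real Q - 1) ^ (leaves C - 1))"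
  have "real Q \<ge> 1" using assms(1) by simp
  then have "y^2 + real Q - 1 \<ge> 0" by (smt (verit) zero_le_power2)
  then have c: "?c \<ge> 0" by simp
  show "pos_semidef r (\<lambda>i j. complex_of_real
      (thompson_tutte x y (g i \<otimes>\<^bsub>thompson_F\<^esub> inv\<^bsub>thompson_F\<^esub> g j)))"
  proof (rule pos_semidef_gram[OF c])
    fix i j assume ij: "i < r" "j < r"
    have "g i \<otimes>\<^bsub>thompson_F\<^esub> inv\<^bsub>thompson_F\<^esub> g j = tree_map (A i) (A j)"
      using A ij by (simp add: thompson_F_inv thompson_F_mult)
    then show "complex_of_real (thompson_tutte x y (g i \<otimes>\<^bsub>thompson_F\<^esub> inv\<^bsub>thompson_F\<^esub> g j)) =
        complex_of_real (?c * (\<Sum>\<sigma>\<in>{0..<leaves C} \<rightarrow>\<^sub>E {..<Q}.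
          tree_weight y 0 (A i) \<sigma> * tree_weight y 0 (A j) \<sigma>))"
      using thompson_tutte_tree_map[OF assms(1) y assms(4), of "A i" "A j"] A ij
      by (simp add: potts_tree_graph)
  qed
qed

end
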